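(* The conserved currents up to second order of the equation $$u_t-u_{txx}+3u^2u_x=uu_{xxx}+2u_xu_{xx}$$ are generated by linear combinations of the currents $$\left(u-u_{xx},\; u^{3}-\tfrac{1}{2}u_{x}^{2}-uu_{xx}\right),$$ $$\left(\tfrac{u^{2}+u_{x}^{2}}{2},\; \tfrac{3}{4}u^{4}-uu_{tx}-u^{2}u_{xx}\right),$$ and $$\Big(\tfrac{1}{4}u^{4}+\tfrac{1}{2}uu_{x}^{2},\; \tfrac{1}{2}u^{6}+\tfrac{1}{8}u_{x}^{4}-\tfrac{1}{2}u_{t}^{2}-uu_{t}u_{x}-\tfrac{1}{2}u^{3}u_{x}^{2}+\tfrac{1}{2}uu_{x}^{2}u_{xx}+\tfrac{1}{2}u_{x}^{2}u_{tx}+\tfrac{1}{2}u_{tx}^{2}+\tfrac{1}{2}u^{2}u_{xx}^{2}-u^{4}u_{xx}+uu_{xx}u_{tx}-u^{3}u_{tx}\Big).$$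
   Context: Independent variables $(t,x)$, dependent variable $u$. A differential function is a smooth function of $(t,x,u)$ and derivatives of $u$ up to a finite, but arbitrary, order; its order is the order of the highest derivative appearing in it. $D_t,D_x$ denote the total derivative operators with respect to $t$ and $x$. A conserved current of an equation $F=0$ is a pair $(C^0,C^1)$ of differential functions such that $D_tC^0+D_xC^1$ vanishes identically on the solutions of the equation; equivalently, $D_tC^0+D_xC^1=\phi F$ for some differential function $\phi$, called the characteristic of the conservation law. The order of a conserved current is the maximum of the orders of its components. The characteristics are assumed to be of the form $\phi=\phi(t,x,u,u_t,u_x,u_{tt},u_{tx},u_{xx})$.
   Formalization: "Generated by linear combinations" is taken modulo trivial currents, i.e. pairs with D_tC^0+D_xC^1 identically zero; literally the claim fails, since (u_x, -u_t) is a conserved current with zero characteristic that is not a linear combination of the three. *)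

theory Defs
  imports "HOL-Analysis.Analysis"
begin

text \<open>
  Jet space: \<open>Deriv a b\<close> is the coordinate of \<open>D\<^sub>t\<^sup>a D\<^sub>x\<^sup>b u\<close>; in particular \<open>Deriv 0 0\<close> is \<open>u\<close> itself.
\<close>

datatype jet_coord = TVar | XVar | Deriv nat nat

type_synonym jet = "jet_coord \<Rightarrow> real"

type_synonym current = "(jet \<Rightarrow> real) \<times> (jet \<Rightarrow> real)"

definition jet_eq_upto :: "nat \<Rightarrow> jet \<Rightarrow> jet \<Rightarrow> bool" where
  "jet_eq_upto n J J' \<longleftrightarrow>
     J TVar = J' TVar \<and> J XVar = J' XVar \<and>
     (\<forall>a b. a + b \<le> n \<longrightarrow> J (Deriv a b) = J' (Deriv a b))"

definition depends_upto :: "nat \<Rightarrow> (jet \<Rightarrow> real) \<Rightarrow> bool" where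
  "depends_upto n f \<longleftrightarrow> (\<forall>J J'. jet_eq_upto n J J' \<longrightarrow> f J = f J')"

definition partial :: "jet_coord \<Rightarrow> (jet \<Rightarrow> real) \<Rightarrow> jet \<Rightarrow> real" where
  "partial c f J = deriv (\<lambda>s. f (J(c := s))) (J c)"

text \<open>
  \<open>C\<^sup>\<infinity>\<close>: all iterated partial derivatives exist and are continuous. For functions of finitely many
  jet coordinates, continuity in the product topology of \<^typ>\<open>jet\<close> is continuity in those
  coordinates.
\<close>

definition smooth :: "(jet \<Rightarrow> real) \<Rightarrow> bool" where
  "smooth f \<longleftrightarrow>
     (\<forall>cs. let g = foldr partial cs f in
        continuous_on UNIV g \<and>
        (\<forall>c J. (\<lambda>s. g (J(c := s))) differentiable at (J c)))"

definition differential_function :: "(jet \<Rightarrow> real) \<Rightarrow> bool" where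
  "differential_function f \<longleftrightarrow> (\<exists>n. depends_upto n f) \<and> smooth f"

text \<open>Functions of \<open>(t, x)\<close> alone and constants get order \<open>0\<close>.\<close>

definition diff_order :: "(jet \<Rightarrow> real) \<Rightarrow> nat" where
  "diff_order f = (LEAST n. depends_upto n f)"

text \<open>The sums below contain every non-vanishing term, since
  \<open>\<partial>f/\<partial>(D\<^sub>t\<^sup>a D\<^sub>x\<^sup>b u) = 0\<close> for \<open>a + b > diff_order f\<close>.\<close>

definition total_t :: "(jet \<Rightarrow> real) \<Rightarrow> jet \<Rightarrow> real" where
  "total_t f J = partial TVar f J +
     (\<Sum>(a, b)\<in>{(a, b). a + b \<le> diff_order f}. J (Deriv (Suc a) b) * partial (Deriv a b) f J)"

definition total_x :: "(jet \<Rightarrow> real) \<Rightarrow> jet \<Rightarrow> real" where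
  "total_x f J = partial XVar f J +
     (\<Sum>(a, b)\<in>{(a, b). a + b \<le> diff_order f}. J (Deriv a (Suc b)) * partial (Deriv a b) f J)"

definition differential_pair :: "current \<Rightarrow> bool" where
  "differential_pair C \<longleftrightarrow> differential_function (fst C) \<and> differential_function (snd C)"

definition total_div :: "current \<Rightarrow> jet \<Rightarrow> real" where
  "total_div C J = total_t (fst C) J + total_x (snd C) J"

definition current_order :: "current \<Rightarrow> nat" where
  "current_order C = max (diff_order (fst C)) (diff_order (snd C))"

definition has_characteristic :: "(jet \<Rightarrow> real) \<Rightarrow> current \<Rightarrow> (jet \<Rightarrow> real) \<Rightarrow> bool" where
  "has_characteristic F C \<phi> \<longleftrightarrow>
     differential_function \<phi> \<and> (\<forall>J. total_div C J = \<phi> J * F J)"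

definition conserved_current :: "(jet \<Rightarrow> real) \<Rightarrow> current \<Rightarrow> bool" where
  "conserved_current F C \<longleftrightarrow> differential_pair C \<and> (\<exists>\<phi>. has_characteristic F C \<phi>)"

text \<open>
  Triviality in the strict sense: the divergence vanishes identically on jet space, not only on the
  solutions.
\<close>

definition trivial_current :: "current \<Rightarrow> bool" where
  "trivial_current C \<longleftrightarrow> differential_pair C \<and> (\<forall>J. total_div C J = 0)"

definition current_diff :: "current \<Rightarrow> current \<Rightarrow> current" where
  "current_diff C C' = ((\<lambda>J. fst C J - fst C' J), (\<lambda>J. snd C J - snd C' J))"

definition lin_comb3 ::
  "real \<Rightarrow> current \<Rightarrow> real \<Rightarrow> current \<Rightarrow> real \<Rightarrow> current \<Rightarrow> current" where
  "lin_comb3 a A b B c C =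
     ((\<lambda>J. a * fst A J + b * fst B J + c * fst C J),
      (\<lambda>J. a * snd A J + b * snd B J + c * snd C J))"

abbreviation "u (J::jet) \<equiv> J (Deriv 0 0)"
abbreviation "u_t (J::jet) \<equiv> J (Deriv 1 0)"
abbreviation "u_x (J::jet) \<equiv> J (Deriv 0 1)"
abbreviation "u_tx (J::jet) \<equiv> J (Deriv 1 1)"
abbreviation "u_xx (J::jet) \<equiv> J (Deriv 0 2)"
abbreviation "u_txx (J::jet) \<equiv> J (Deriv 1 2)"
abbreviation "u_xxx (J::jet) \<equiv> J (Deriv 0 3)"

definition eqn :: "jet \<Rightarrow> real" where
  "eqn J = u_t J - u_txx J + 3 * (u J)^2 * u_x J - (u J * u_xxx J + 2 * u_x J * u_xx J)"

text \<open>Conserved currents up to second order of \<open>eqn = 0\<close> with characteristic of the form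
  \<open>\<phi>(t, x, u, u_t, u_x, u_tt, u_tx, u_xx)\<close>.\<close>

definition second_order_conserved_current :: "current \<Rightarrow> bool" where
  "second_order_conserved_current C \<longleftrightarrow>
     conserved_current eqn C \<and> current_order C \<le> 2 \<and>
     (\<exists>\<phi>. has_characteristic eqn C \<phi> \<and> diff_order \<phi> \<le> 2)"

definition current1 :: current where
  "current1 =
     ((\<lambda>J. u J - u_xx J),
      (\<lambda>J. (u J)^3 - 1/2 * (u_x J)^2 - u J * u_xx J))"

definition current2 :: current where
  "current2 =
     ((\<lambda>J. ((u J)^2 + (u_x J)^2) / 2),
      (\<lambda>J. 3/4 * (u J)^4 - u J * u_tx J - (u J)^2 * u_xx J))"

definition current3 :: current where
  "current3 =
     ((\<lambda>J. 1/4 * (u J)^4 + 1/2 * u J * (u_x J)^2),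
      (\<lambda>J. 1/2 * (u J)^6 + 1/8 * (u_x J)^4 - 1/2 * (u_t J)^2 - u J * u_t J * u_x J
         - 1/2 * (u J)^3 * (u_x J)^2 + 1/2 * u J * (u_x J)^2 * u_xx J
         + 1/2 * (u_x J)^2 * u_tx J + 1/2 * (u_tx J)^2 + 1/2 * (u J)^2 * (u_xx J)^2
         - (u J)^4 * u_xx J + u J * u_xx J * u_tx J - (u J)^3 * u_tx J))"

end

theory Submission
  imports Defs
begin

text \<open>
  A divergence identity \<open>D\<^sub>t A + D\<^sub>x B = \<phi> F\<close> with \<open>A\<close>, \<open>B\<close>, \<open>\<phi>\<close> of second order is affine in the
  third-order derivatives of \<open>u\<close>, since \<open>F\<close> is. Comparing coefficients turns it into five
  first-order linear equations for three functions of the eight coordinates of the second-order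
  jet space. The theorem follows once these equations force
  \<open>\<phi> = a + b u + c (u\<^sup>3 - u u\<^sub>x\<^sub>x - u\<^sub>x\<^sup>2/2 - u\<^sub>t\<^sub>x)\<close> with constants \<open>a\<close>, \<open>b\<close>, \<open>c\<close>: the three functions
  combined here are the characteristics of the three currents, so \<open>(A, B)\<close> and the same combination of
  the currents have the same divergence, and their difference is trivial. The converse is the
  linearity of the divergence.

  The overdetermined system is solved by differentiation alone. Write \<open>p = u\<^sub>t\<close>, \<open>q = u\<^sub>x\<close>,
  \<open>r = u\<^sub>t\<^sub>t\<close>, \<open>w = u\<^sub>x\<^sub>x\<close>, and replace the coordinate \<open>u\<^sub>t\<^sub>x\<close> by \<open>z = u\<^sub>t\<^sub>x + u u\<^sub>x\<^sub>x\<close>; this is natural because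
  \<open>F = p + 3 u\<^sup>2 q - q w - D\<^sub>x z\<close>. The system then says that \<open>A\<close> is independent of \<open>r\<close> and that its
  dependence on \<open>z\<close> and \<open>w\<close> separates, and cross-derivatives yield successively smaller systems for
  \<open>A\<^sub>z\<^sub>z\<close>, \<open>A\<^sub>w\<^sub>w\<close>, \<open>\<phi>\<^sub>z\<close>, \<open>\<phi>\<^sub>p\<close>. Adding a trivial current \<open>(D\<^sub>x \<theta>, - D\<^sub>t \<theta>)\<close> changes \<open>A\<close> and \<open>B\<close> but not
  \<open>\<phi>\<close>. Instead of normalising this freedom by integration, one eliminates it: the system gives
  \<open>B\<^sub>z\<close>, \<open>B\<^sub>w\<close>, \<open>B\<^sub>r\<close> directly and \<open>B\<^sub>p\<close>, \<open>B\<^sub>q\<close>, \<open>B\<^sub>u\<close> after one differentiation, and once these are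
  substituted, a further consequence of the system either expresses a derivative of \<open>A\<close> through
  others, as in \<open>A_P\<close>, \<open>A_QQ\<close> and \<open>A_U\<close>, or is a condition on the characteristic. Since only sums,
  products and commuting derivatives occur, this is done in an abstract commutative ring with
  derivations (\<open>conservation_law.characteristic\<close>).

  The ring is then instantiated with the smooth functions on jet space. This needs that
  smoothness, defined through iterated partial derivatives, is preserved by sums and products
  (\<open>smooth_algebra_smooth\<close>) and that partial derivatives commute (\<open>partial_commute\<close>).
\<close>

section \<open>Differential rings in eight variables\<close>

text \<open>
  \<open>T, X, U, P, Q, R, Z, W\<close> name the coordinates \<open>t\<close>, \<open>x\<close>, \<open>u\<close>, \<open>u\<^sub>t\<close>, \<open>u\<^sub>x\<close>, \<open>u\<^sub>t\<^sub>t\<close>, \<open>u\<^sub>t\<^sub>x + u u\<^sub>x\<^sub>x\<close>, \<open>u\<^sub>x\<^sub>x\<close>.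
\<close>

datatype coord = T | X | U | P | Q | R | Z | W

locale differential_ring =
  fixes d :: "coord \<Rightarrow> 'a::comm_ring_1 \<Rightarrow> 'a" and v :: "coord \<Rightarrow> 'a"
  assumes d_add: "d i (x + y) = d i x + d i y"
    and d_mult: "d i (x * y) = d i x * y + x * d i y"
    and d_commute: "d i (d j x) = d j (d i x)"
    and d_v: "d i (v j) = (if i = j then 1 else 0)"
    and torsion_free: "numeral n * x = 0 \<Longrightarrow> x = (0::'a)"
begin

lemma d_zero: "d i 0 = 0" using d_add[of i 0 0] by simp

lemma d_one: "d i 1 = 0" using d_mult[of i 1 1] by simp

lemma d_uminus: "d i (- x) = - d i x"
  using d_add[of i x "- x"] d_zero[of i] by (simp add: eq_neg_iff_add_eq_0 add.commute)

lemma d_diff: "d i (x - y) = d i x - d i y"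
  using d_add[of i x "- y"] d_uminus by simp

lemma d_numeral: "d i (numeral n) = 0"
  by (induction n) (simp_all only: numeral.simps d_add d_one add_0_left)

lemma d_square: "d i (x^2) = 2 * x * d i x"
  by (simp add: power2_eq_square d_mult)

lemmas leibniz = d_zero d_one d_uminus d_diff d_numeral d_add d_mult d_square

abbreviation "uu \<equiv> v U"
abbreviation "pp \<equiv> v P"
abbreviation "qq \<equiv> v Q"
abbreviation "rr \<equiv> v R"
abbreviation "zz \<equiv> v Z"
abbreviation "ww \<equiv> v W"

text \<open>The total derivatives of functions of \<open>(t, x, u)\<close>, applied to arbitrary ring elements.\<close>

abbreviation "Dt f \<equiv> d T f + pp * d U f"
abbreviation "Dx f \<equiv> d X f + qq * d U f"

lemma d_coord:
  "d T uu = 0" "d X uu = 0" "d U uu = 1" "d P uu = 0" "d Q uu = 0" "d R uu = 0" "d Z uu = 0" "d W uu = 0"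
  "d T pp = 0" "d X pp = 0" "d U pp = 0" "d P pp = 1" "d Q pp = 0" "d R pp = 0" "d Z pp = 0" "d W pp = 0"
  "d T qq = 0" "d X qq = 0" "d U qq = 0" "d P qq = 0" "d Q qq = 1" "d R qq = 0" "d Z qq = 0" "d W qq = 0"
  "d T rr = 0" "d X rr = 0" "d U rr = 0" "d P rr = 0" "d Q rr = 0" "d R rr = 1" "d Z rr = 0" "d W rr = 0"
  "d T zz = 0" "d X zz = 0" "d U zz = 0" "d P zz = 0" "d Q zz = 0" "d R zz = 0" "d Z zz = 1" "d W zz = 0"
  "d T ww = 0" "d X ww = 0" "d U ww = 0" "d P ww = 0" "d Q ww = 0" "d R ww = 0" "d Z ww = 0" "d W ww = 1"
  by (simp_all add: d_v)

text \<open>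
  Oriented commutation: \<open>Z\<close> moves innermost, followed by \<open>W, R, P, Q, U, T\<close>, with \<open>X\<close> outermost.
  The derivatives that become known first are thus innermost, where rewrite rules for them apply.
\<close>

lemma d_swap:
  "d Z (d W f) = d W (d Z f)" "d Z (d R f) = d R (d Z f)" "d Z (d P f) = d P (d Z f)"
  "d Z (d Q f) = d Q (d Z f)" "d Z (d U f) = d U (d Z f)" "d Z (d T f) = d T (d Z f)"
  "d Z (d X f) = d X (d Z f)"
  "d W (d R f) = d R (d W f)" "d W (d P f) = d P (d W f)" "d W (d Q f) = d Q (d W f)"
  "d W (d U f) = d U (d W f)" "d W (d T f) = d T (d W f)" "d W (d X f) = d X (d W f)"
  "d R (d P f) = d P (d R f)" "d R (d Q f) = d Q (d R f)" "d R (d U f) = d U (d R f)"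
  "d R (d T f) = d T (d R f)" "d R (d X f) = d X (d R f)"
  "d P (d Q f) = d Q (d P f)" "d P (d U f) = d U (d P f)" "d P (d T f) = d T (d P f)"
  "d P (d X f) = d X (d P f)"
  "d Q (d U f) = d U (d Q f)" "d Q (d T f) = d T (d Q f)" "d Q (d X f) = d X (d Q f)"
  "d U (d T f) = d T (d U f)" "d U (d X f) = d X (d U f)" "d T (d X f) = d X (d T f)"
  by (rule d_commute)+

lemmas calc = leibniz d_coord d_swap

text \<open>
  With \<open>to_poly\<close>, the simplifier proves identities between polynomials in derivatives by bringing
  them to normal form. A consequence of a known equation is stated by
  exhibiting the difference of its sides as the difference of the sides of the known one, which is
  such an identity.
\<close>

lemmas to_poly = calc algebra_simps power2_eq_square power3_eq_cube power4_eq_xxxx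

lemma by_difference: "x = y \<Longrightarrow> l - r = x - y \<Longrightarrow> l = (r::'a)"
  by simp

text \<open>
  On functions of \<open>(x, u, p, q, z)\<close>, the total derivative \<open>D\<^sub>x\<close> along solutions is \<open>V2 + w V1\<close>: there
  \<open>D\<^sub>x p = z - u w\<close>, \<open>D\<^sub>x q = w\<close>, and the equation itself is \<open>D\<^sub>x z = p + 3 u\<^sup>2 q - q w\<close>. A function
  whose \<open>D\<^sub>x\<close> vanishes is annihilated by both fields, hence by the Lie algebra they generate.
\<close>

definition V1 where "V1 f = d Q f - uu * d P f - qq * d Z f"
definition V2 where "V2 f = Dx f + zz * d P f + (pp + 3 * uu^2 * qq) * d Z f"
definition V3 where "V3 f = d U f + (3 * uu^2 - uu) * d Z f"

lemma V1_V2: "V1 (V2 f) - V2 (V1 f) = V3 f"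
  unfolding V1_def V2_def V3_def by (simp add: to_poly)

lemma V1_V3: "V1 (V3 f) - V3 (V1 f) = d P f"
  unfolding V1_def V2_def V3_def by (simp add: to_poly)

lemma P_V2: "d P (V2 f) - V2 (d P f) = d Z f"
  unfolding V1_def V2_def V3_def by (simp add: to_poly)

lemma V_zero: "V1 0 = 0" "V2 0 = 0" "V3 0 = 0"
  by (simp_all add: V1_def V2_def V3_def d_zero)

text \<open>
  The commutators of \<open>V1\<close> and \<open>V2\<close> span all directions in \<open>(x, u, p, q, z)\<close>: the equation admits no
  non-constant function of these variables that is constant in \<open>x\<close> along solutions.
\<close>

lemma annihilated:
  assumes "V1 f = 0" "V2 f = 0"
  shows "d Z f = 0" "d P f = 0" "d U f = 0" "d Q f = 0" "d X f = 0"
proof -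
  have V3: "V3 f = 0" using V1_V2[of f] assms by (simp add: V_zero)
  show P: "d P f = 0" using V1_V3[of f] assms V3 by (simp add: V_zero)
  show Z: "d Z f = 0" using P_V2[of f] assms P by (simp add: V_zero d_zero)
  show U: "d U f = 0" using V3 Z by (simp add: V3_def)
  show Q: "d Q f = 0" using assms(1) Z P by (simp add: V1_def)
  show "d X f = 0" using assms(2) Z P U by (simp add: V2_def)
qed

end

section \<open>The characteristics of second order\<close>

text \<open>
  The five equations are the coefficients of \<open>u\<^sub>t\<^sub>t\<^sub>t\<close>, \<open>u\<^sub>t\<^sub>t\<^sub>x\<close>, \<open>u\<^sub>t\<^sub>x\<^sub>x\<close>, \<open>u\<^sub>x\<^sub>x\<^sub>x\<close> and \<open>1\<close> in the divergence
  identity. In the adapted coordinates \<open>u\<^sub>t\<^sub>x = z - u w\<close>, and for the original coordinates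
  \<open>\<partial>/\<partial>u\<^sub>t\<^sub>x = d Z\<close>, \<open>\<partial>/\<partial>u\<^sub>x\<^sub>x = d W + u d Z\<close>, \<open>\<partial>/\<partial>u = d U + w d Z\<close>.
\<close>

locale conservation_law = differential_ring d v for d :: "coord \<Rightarrow> 'a::comm_ring_1 \<Rightarrow> 'a" and v +
  fixes A B \<phi> :: 'a
  assumes A_R: "d R A = 0"
    and AB_Z: "d Z A + d R B = 0"
    and AB_W: "d W A + uu * d Z A + d Z B = - \<phi>"
    and B_W_phi: "d W B + uu * d Z B = - (uu * \<phi>)"
    and balance: "d T A + pp * (d U A + ww * d Z A) + rr * d P A + (zz - uu * ww) * d Q A
      + (d X B + qq * (d U B + ww * d Z B) + (zz - uu * ww) * d P B + ww * d Q B)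
      = \<phi> * (pp + 3 * uu^2 * qq - 2 * qq * ww)"
begin

definition "Az = d Z A"
definition "Aw = d W A"
definition "Azz = d Z Az"
definition "Aww = d W Aw"
definition "\<phi>z = d Z \<phi>"
definition "\<phi>p = d P \<phi>"
definition "\<phi>pp = d P \<phi>p"

lemma A_Z: "d Z A = Az" and A_W: "d W A = Aw" and Az_Z: "d Z Az = Azz" and Aw_W: "d W Aw = Aww"
  and phi_Z: "d Z \<phi> = \<phi>z" and phi_P: "d P \<phi> = \<phi>p" and phip_P: "d P \<phi>p = \<phi>pp"
  by (simp_all add: Az_def Aw_def Azz_def Aww_def \<phi>z_def \<phi>p_def \<phi>pp_def)

lemma B_R: "d R B = - Az"
  using AB_Z by (simp add: A_Z eq_neg_iff_add_eq_0 add.commute)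

lemma B_Z: "d Z B = - \<phi> - Aw - uu * Az"
  by (rule by_difference[OF AB_W]) (simp add: A_Z A_W algebra_simps)

lemma B_W: "d W B = uu * Aw + uu^2 * Az"
  by (rule by_difference[OF B_W_phi]) (simp add: B_Z algebra_simps power2_eq_square)

lemma Az_R: "d R Az = 0" and Aw_R: "d R Aw = 0"
  using d_commute[of R _ A] by (simp_all add: Az_def Aw_def A_R d_zero)

text \<open>The condition \<open>B\<^sub>r\<^sub>w = B\<^sub>w\<^sub>r\<close> separates \<open>A\<close> into a function of \<open>z\<close> plus a function of \<open>w\<close>.\<close>

lemma Az_W: "d W Az = 0"
  using d_commute[of R W B] by (simp add: B_W B_R Az_R Aw_R calc power2_eq_square)

lemma Aw_Z: "d Z Aw = 0"
  using d_commute[of Z W A] by (simp add: A_W A_Z Az_W)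

lemma Azz_R: "d R Azz = 0" and Azz_W: "d W Azz = 0"
  using d_commute[of _ Z Az] by (simp_all add: Azz_def Az_R Az_W d_zero)

lemma phi_R: "d R \<phi> = Azz"
  using d_commute[of R Z B] by (simp add: B_Z B_R Az_R Aw_R Az_Z calc)

lemmas reductions = A_R A_Z A_W Az_R Az_W Az_Z Aw_R Aw_Z Aw_W Azz_R Azz_W phi_R phi_Z phi_P
  phip_P B_R B_Z B_W

text \<open>The coefficient of \<open>r\<close> in \<open>balance\<close>.\<close>

lemma A_P: "d P A = Dx Az + zz * d P Az + ww * (d Q Az - uu * d P Az)
    + Azz * (pp + 3 * uu^2 * qq - qq * ww)"
  by (rule by_difference[OF arg_cong[OF balance, of "d R"]]) (simp add: reductions to_poly)

subsection \<open>The coefficient \<open>A\<^sub>z\<^sub>z\<close> of \<open>u\<^sub>t\<^sub>t\<close> in \<open>\<phi>\<close> depends on \<open>t\<close> only\<close>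

lemma V_Azz: "V2 Azz + ww * V1 Azz = 0"
  by (rule by_difference[OF d_commute[of Z P A]])
    (simp add: reductions A_P V1_def V2_def to_poly)

lemma V1_Azz: "V1 Azz = 0"
  by (rule by_difference[OF arg_cong[OF V_Azz, of "d W"]])
    (simp add: reductions d_commute[of W Z Azz] V1_def V2_def to_poly)

lemma V2_Azz: "V2 Azz = 0"
  using V_Azz V1_Azz by simp

lemmas Azz_const = annihilated[OF V1_Azz V2_Azz]

lemma Aw_P: "d P Aw = d Q Az - uu * d P Az - Azz * qq"
  by (rule by_difference[OF d_commute[of P W A]]) (simp add: reductions Azz_const A_P to_poly)

subsection \<open>\<open>A\<close> is affine in \<open>w\<close>\<close>

text \<open>
  Differentiating \<open>balance\<close> twice in \<open>w\<close> leaves an equation for \<open>A\<^sub>w\<^sub>w\<close> alone. As \<open>A\<^sub>w\<^sub>w\<close> is independent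
  of \<open>z\<close> and \<open>p\<close>, the coefficients of \<open>z\<close>, \<open>p\<close> and \<open>q\<close> vanish separately.
\<close>

lemma Aww_R: "d R Aww = 0" and Aww_Z: "d Z Aww = 0"
  using d_commute[of _ W Aw] by (simp_all add: Aw_W Aw_R Aw_Z d_zero)

lemma Aww_P: "d P Aww = 0"
  using d_commute[of P W Aw] by (simp add: Aw_P reductions Azz_const to_poly)

lemma phi_W_Aww: "d W \<phi> = - Aww - uu^2 * Azz"
  by (rule by_difference[OF d_commute[of Z W B]]) (simp add: reductions Azz_const to_poly)

lemma Aww_balance:
  "Dt Aww + zz * d Q Aww + uu * Dx Aww - 3 * qq * Aww
    + d W Aww * (pp + 3 * uu^2 * qq - 2 * qq * ww) = 0"
  by (rule by_difference[OF arg_cong[OF balance, of "\<lambda>f. d W (d W f)"]])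
    (simp add: reductions Azz_const phi_W_Aww A_P Aw_P Aww_R Aww_Z Aww_P to_poly)

lemma Aww_Q: "d Q Aww = 0"
  by (rule by_difference[OF arg_cong[OF Aww_balance, of "d Z"]])
    (simp add: Aww_R Aww_Z Aww_P to_poly)

lemma Aww_U: "d U Aww = - d W Aww"
  by (rule by_difference[OF arg_cong[OF Aww_balance, of "d P"]])
    (simp add: Aww_R Aww_Z Aww_P Aww_Q d_commute[of P W] to_poly)

lemma Aww_UW: "d U (d W Aww) = - d W (d W Aww)"
  using d_commute[of U W Aww] by (simp add: Aww_U d_uminus)

lemma Aww_W_quadratic: "(3 * uu^2 - uu - 2 * ww) * d W Aww = 3 * Aww"
  by (rule by_difference[OF arg_cong[OF Aww_balance, of "d Q"]])
    (simp add: Aww_R Aww_Z Aww_P Aww_Q Aww_U d_commute[of Q W] to_poly)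

text \<open>
  By \<open>Aww_U\<close>, the derivation \<open>d U + d W\<close> kills \<open>A\<^sub>w\<^sub>w\<close>. Applying it repeatedly differentiates only the
  polynomial factor, until a number is left.
\<close>

lemma Aww_W_linear: "(6 * uu - 3) * d W Aww = 0"
  by (rule by_difference[OF arg_cong[OF Aww_W_quadratic, of "\<lambda>f. d U f + d W f"]])
    (simp add: Aww_U Aww_UW to_poly)

lemma Aww_W: "d W Aww = 0"
proof (rule torsion_free)
  show "6 * d W Aww = 0"
    by (rule by_difference[OF arg_cong[OF Aww_W_linear, of "\<lambda>f. d U f + d W f"]])
      (simp add: Aww_U Aww_UW to_poly)
qed

lemma Aww_0: "Aww = 0"
  using Aww_W_quadratic Aww_W torsion_free[of _ Aww] by simp

lemma phi_W: "d W \<phi> = - (uu^2 * Azz)"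
  using phi_W_Aww Aww_0 by simp

subsection \<open>The dependence of \<open>\<phi>\<close> on \<open>z\<close>\<close>

lemma phiz_R: "d R \<phi>z = 0" and phiz_W: "d W \<phi>z = 0"
  using d_commute[of _ Z \<phi>] by (simp_all add: phi_Z phi_R phi_W Azz_const to_poly)

lemma phip_Z: "d Z \<phi>p = d P \<phi>z" and phip_R: "d R \<phi>p = 0" and phip_W: "d W \<phi>p = 0"
  using d_commute[of _ P \<phi>] by (simp_all add: phi_P phi_Z phi_R phi_W Azz_const to_poly)

text \<open>
  The second derivatives of \<open>balance\<close> in \<open>z, w\<close> and in \<open>z, z\<close> involve \<open>A\<close> only through \<open>A\<^sub>z\<^sub>z\<close>: they
  are \<open>V1_phi\<close> and \<open>V2_phiz\<close>.
\<close>

lemma V1_phi: "V1 \<phi> = Azz * (pp - qq * uu)"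
  by (rule by_difference[OF arg_cong[OF balance, of "\<lambda>f. - d W (d Z f)"]])
    (simp add: reductions Azz_const Aww_0 phi_W A_P Aw_P phiz_W phip_W V1_def to_poly)

lemma phi_Q: "d Q \<phi> = uu * \<phi>p + qq * \<phi>z + Azz * (pp - qq * uu)"
  by (rule by_difference[OF V1_phi]) (simp add: V1_def phi_P phi_Z)

lemma V1_phiz: "V1 \<phi>z = 0"
  by (rule by_difference[OF d_commute[of Q Z \<phi>]])
    (simp add: phi_Q phi_Z phip_Z V1_def Azz_const to_poly)

lemma phiz_Q: "d Q \<phi>z = uu * d P \<phi>z + qq * d Z \<phi>z"
  by (rule by_difference[OF V1_phiz]) (simp add: V1_def)

lemma V2_phiz: "V2 \<phi>z = d T Azz + Azz * qq - 2 * \<phi>p"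
  by (rule by_difference[OF arg_cong[OF balance, of "\<lambda>f. - d Z (d Z f)"]])
    (simp add: reductions Azz_const Aww_0 phi_W A_P Aw_P phi_Q phip_Z phiz_Q V2_def to_poly)

lemma phip_Q: "d Q \<phi>p = uu * \<phi>pp + qq * d P \<phi>z + Azz"
  by (rule by_difference[OF d_commute[of Q P \<phi>]])
    (simp add: phi_Q phi_P phip_P Azz_const to_poly)

text \<open>
  The commutator relations that proved \<open>annihilated\<close>, now with the right-hand side of \<open>V2_phiz\<close>:
  they determine all derivatives of \<open>\<phi>\<^sub>z\<close>, except the one in \<open>t\<close>, in terms of \<open>\<phi>\<^sub>p\<close>, \<open>\<phi>\<^sub>p\<^sub>p\<close>, \<open>A\<^sub>z\<^sub>z\<close> and
  its \<open>t\<close>-derivative.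
\<close>

lemma V3_phiz: "V3 \<phi>z = - Azz"
  by (rule by_difference[OF V1_V2[of \<phi>z, symmetric]])
    (simp add: V1_phiz V2_phiz V_zero, simp add: V1_def phip_P phip_Q phip_Z Azz_const to_poly)

lemma phiz_P: "d P \<phi>z = 0"
  by (rule by_difference[OF V1_V3[of \<phi>z, symmetric]])
    (simp add: V3_phiz V1_phiz V_zero, simp add: V1_def Azz_const to_poly)

lemma phiz_Z: "d Z \<phi>z = - 2 * \<phi>pp"
  by (rule by_difference[OF P_V2[of \<phi>z, symmetric]])
    (simp add: V2_phiz phiz_P V_zero, simp add: phip_P Azz_const d_commute[of P T] to_poly)

lemma phiz_U: "d U \<phi>z = 2 * (3 * uu^2 - uu) * \<phi>pp - Azz"
  by (rule by_difference[OF V3_phiz]) (simp add: V3_def phiz_Z algebra_simps)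

lemma phiz_X: "d X \<phi>z = d T Azz + 2 * Azz * qq - 2 * \<phi>p + 2 * \<phi>pp * (pp + uu * qq)"
  by (rule by_difference[OF V2_phiz]) (simp add: V2_def phiz_Z phiz_P phiz_U to_poly)

lemma phipp_const:
  shows "d Z \<phi>pp = 0" "d P \<phi>pp = 0" "d U \<phi>pp = 0" "d Q \<phi>pp = 0" "d X \<phi>pp = 0"
proof -
  have V1: "V1 (d Z \<phi>z) = 0"
    using arg_cong[OF V1_phiz, of "d Z"] by (simp add: V1_def to_poly)
  have V2: "V2 (d Z \<phi>z) = 0"
    by (rule by_difference[OF arg_cong[OF V2_phiz, of "d Z"]])
      (simp add: V2_def Azz_const phip_Z phiz_P d_commute[of P Z \<phi>z] to_poly)
  have *: "d i \<phi>pp = 0" if "d i (d Z \<phi>z) = 0" for i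
    using that torsion_free[of _ "d i \<phi>pp"] by (simp add: phiz_Z calc)
  show "d Z \<phi>pp = 0" "d P \<phi>pp = 0" "d U \<phi>pp = 0" "d Q \<phi>pp = 0" "d X \<phi>pp = 0"
    using annihilated[OF V1 V2] * by blast+
qed

lemmas reductions1 = reductions Azz_const Aww_0 phi_W A_P Aw_P phi_Q
  phiz_R phiz_W phiz_Z phiz_P phiz_Q phiz_U phiz_X
  phip_Z phip_R phip_W phip_Q phipp_const

subsection \<open>\<open>\<phi>\<close> is affine in \<open>p\<close>\<close>

text \<open>The derivatives of \<open>balance\<close> in \<open>z\<close> and \<open>w\<close>, solved for \<open>B\<^sub>p\<close> and \<open>B\<^sub>q\<close>.\<close>

lemma B_P:
  "d P B = Dx Aw + uu * Dx Az - Dt Az + Dx \<phi> - d Q A + qq * Az - rr * d P Az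
    + ww * (uu * d Q Az + d Q Aw) + (pp + 3 * uu^2 * qq) * \<phi>z + zz * \<phi>p
    - Azz * qq * (zz - uu * ww)"
  by (rule by_difference[OF arg_cong[OF balance, of "d Z"]])
    (simp add: reductions1 to_poly)

lemma B_Q:
  "d Q B = uu * Dx \<phi> - Dt Aw - uu * Dt Az - pp * Az - rr * d Q Az
    - (zz - uu * ww) * (d Q Aw + uu * d Q Az) - qq * \<phi>
    + uu * (pp + 3 * uu^2 * qq) * \<phi>z + uu * zz * \<phi>p
    + Azz * (qq * rr - pp * uu^2 + qq * uu^2 * ww - 3 * qq * uu^4)"
  by (rule by_difference[OF arg_cong[OF balance, of "d W"]])
    (simp add: reductions1 B_P to_poly)

lemma A_QQ:
  "d Q (d Q A) = 2 * Az + qq * d Q Az + zz * d Q (d Q Az) + uu * Dx (d Q Az) + 2 * uu * d U Az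
    + ww * d Q (d Q Aw) + Dx (d Q Aw) + 2 * d U Aw + d U \<phi> + (3 * uu^2 - uu) * \<phi>z
    + Azz * (2 * uu * ww + uu^2 - zz)"
  by (rule by_difference[OF d_commute[of P Q B]])
    (simp add: reductions1 B_P B_Q to_poly)

text \<open>
  In the \<open>p\<close>-derivative of \<open>A_QQ\<close> all derivatives of \<open>A\<close> cancel by \<open>A_P\<close> and \<open>Aw_P\<close>; what remains is
  a condition on the characteristic.
\<close>

lemma phip_U: "d U \<phi>p = 0"
  by (rule by_difference[OF arg_cong[OF A_QQ, of "\<lambda>f. - d P f"]])
    (simp add: reductions1 to_poly)

lemma phipp_0: "\<phi>pp = 0"
proof -
  have *: "2 * \<phi>pp * qq = 0"
    by (rule by_difference[OF d_commute[of U X \<phi>z]])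
      (simp add: reductions1 phip_U to_poly)
  have "2 * \<phi>pp = 0"
    by (rule by_difference[OF arg_cong[OF *, of "d Q"]])
      (simp add: reductions1 to_poly)
  then show ?thesis by (rule torsion_free)
qed

lemmas reductions2 = reductions1 phipp_0 phip_U A_QQ B_P B_Q

subsection \<open>\<open>\<phi>\<close> is independent of \<open>u\<^sub>t\<^sub>t\<close> and of \<open>p\<close>\<close>

text \<open>
  With \<open>B\<^sub>p\<close> and \<open>B\<^sub>q\<close> known, \<open>B\<close> drops out of the second derivatives of \<open>balance\<close> in \<open>p, p\<close> and
  \<open>p, q\<close>. The coefficient of \<open>q u\<close> in the first of them forces \<open>A\<^sub>z\<^sub>z = 0\<close>.
\<close>

lemma phip_XX_Azz: "2 * d T Azz - 4 * \<phi>p + d X (d X \<phi>p) + Azz * qq + 6 * Azz * qq * uu = 0"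
  by (rule by_difference[OF arg_cong[OF balance, of "\<lambda>f. d P (d P f)"]])
    (simp add: reductions2 to_poly)

lemma Azz_0: "Azz = 0"
proof -
  have *: "6 * (Azz * qq) = 0"
    by (rule by_difference[OF arg_cong[OF phip_XX_Azz, of "d U"]])
      (simp add: reductions2 to_poly)
  have "6 * Azz = 0"
    by (rule by_difference[OF arg_cong[OF *, of "d Q"]])
      (simp add: reductions2 to_poly)
  then show ?thesis by (rule torsion_free)
qed

lemma phip_XX: "d X (d X \<phi>p) = 4 * \<phi>p"
  using phip_XX_Azz by (simp add: Azz_0 d_zero)

lemma phi_UU: "d U (d U \<phi>) = - d X \<phi>p - 6 * uu * \<phi>z"
  by (rule by_difference[OF arg_cong[OF balance, of "\<lambda>f. d Q (d Q (d P f))"]])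
    (simp add: reductions2 Azz_0 phip_XX to_poly)

lemma phi_UX: "d X (d U \<phi>) = qq * d X \<phi>p - uu * \<phi>p + 3 * uu^2 * \<phi>p"
  by (rule by_difference[OF arg_cong[OF balance, of "\<lambda>f. d Q (d P f)"]])
    (simp add: reductions2 Azz_0 phip_XX phi_UU to_poly)

text \<open>The two preceding equations are compatible only for \<open>(2 u - 1) \<phi>\<^sub>p = 0\<close>.\<close>

lemma phip_0: "\<phi>p = 0"
proof -
  have *: "6 * (\<phi>p * uu) - 3 * \<phi>p = 0"
    by (rule by_difference[OF d_commute[of X U "d U \<phi>"]])
      (simp add: reductions2 Azz_0 phip_XX phi_UU phi_UX to_poly)
  have "6 * \<phi>p = 0"
    by (rule by_difference[OF arg_cong[OF *, of "d U"]])
      (simp add: reductions2 to_poly)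
  then show ?thesis by (rule torsion_free)
qed

lemmas reductions3 = reductions2 Azz_0 phip_0 phi_UU phi_UX

subsection \<open>The coefficients of \<open>\<phi>\<close> are constants\<close>

lemma phi_UT_phiz: "d T (d U \<phi>) + d X \<phi> + (3 * uu^2 - uu) * d T \<phi>z = 0"
  by (rule by_difference[OF arg_cong[OF balance, of "\<lambda>f. d Q (d Q f)"]])
    (simp add: reductions3 to_poly)

lemma phiz_T: "d T \<phi>z = 0"
  by (rule by_difference[OF arg_cong[OF phi_UT_phiz, of "\<lambda>f. - d U f"]])
    (simp add: reductions3 to_poly)

lemma phi_UT: "d T (d U \<phi>) = - d X \<phi>"
  using phi_UT_phiz by (simp add: phiz_T eq_neg_iff_add_eq_0)

lemma phi_XX: "d X (d X \<phi>) = 0"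
  using d_commute[of T X "d U \<phi>"] by (simp add: reductions3 phi_UT calc)

lemmas reductions4 = reductions3 phiz_T phi_UT phi_XX

text \<open>
  The derivatives of \<open>balance\<close> in \<open>p\<close> and \<open>q\<close>, solved for \<open>A\<^sub>u\<close> and \<open>B\<^sub>u\<close>. They eliminate \<open>A\<close> and \<open>B\<close> from
  the derivative in \<open>u\<close>, which is \<open>phi_T_X\<close>.
\<close>

lemma A_U:
  "d U A = Dx (d Q A) - Dx (Dx Aw) - uu * Dx (Dx Az) - 2 * qq * Dx Az
    - zz * (Dx (d Q Az) - d U Az) - ww * (Dx (d Q Aw) - d U Aw) + \<phi> - zz * \<phi>z"
  by (rule by_difference[OF arg_cong[OF balance, of "d P"]])
    (simp add: reductions4 to_poly)

lemma B_U:
  "d U B = Dt (Dx Aw) + uu * Dt (Dx Az) - Dt (d Q A) + qq * Dt Az + pp * Dx Az - rr * d U Az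
    + zz * (Dt (d Q Az) - Az - d U Aw - uu * d U Az - d U \<phi>)
    + ww * (Dt (d Q Aw) + Aw + 2 * uu * Az + uu^2 * d U Az + uu * d U Aw)
    + 3 * uu^2 * (\<phi> - zz * \<phi>z)"
  by (rule by_difference[OF arg_cong[OF balance, of "d Q"]])
    (simp add: reductions4 A_U to_poly)

lemma phi_T_X: "d T \<phi> + 3 * uu^2 * d X \<phi> = 0"
  by (rule by_difference[OF arg_cong[OF balance, of "d U"]])
    (simp add: reductions4 A_U B_U to_poly)

lemma phi_X: "d X \<phi> = 0"
proof -
  have *: "6 * (uu * d X \<phi>) - d X \<phi> = 0"
    by (rule by_difference[OF arg_cong[OF phi_T_X, of "d U"]])
      (simp add: reductions4 to_poly)
  have "6 * d X \<phi> = 0"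
    by (rule by_difference[OF arg_cong[OF *, of "d U"]])
      (simp add: reductions4 to_poly)
  then show ?thesis by (rule torsion_free)
qed

lemma phi_T: "d T \<phi> = 0"
  using phi_T_X phi_X by simp

text \<open>
  At this point \<open>\<phi>\<^sub>z\<close> is constant, \<open>\<phi>\<^sub>q = q \<phi>\<^sub>z\<close>, \<open>\<phi>\<^sub>u\<^sub>u = - 6 u \<phi>\<^sub>z\<close>, and \<open>\<phi>\<close> depends on no other coordinate.
  The factor \<open>2\<close> avoids denominators in the ring.
\<close>

theorem characteristic:
  "\<exists>g b e. (\<forall>i. d i g = 0 \<and> d i b = 0 \<and> d i e = 0) \<and>
     2 * \<phi> = g * (2 * zz + qq^2 - 2 * uu^3) + 2 * b * uu + e"
proof -
  define b where "b = d U \<phi> + 3 * uu^2 * \<phi>z"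
  define e where "e = 2 * \<phi> - \<phi>z * (2 * zz + qq^2 - 2 * uu^3) - 2 * b * uu"
  note rules = reductions4 phi_X phi_T
  have g: "d i \<phi>z = 0" for i
    by (cases i) (simp_all add: rules d_zero)
  have b: "d i b = 0" for i
    by (cases i) (simp_all add: b_def rules to_poly)
  have phi_U: "d U \<phi> = b - 3 * uu^2 * \<phi>z"
    by (simp add: b_def)
  have e: "d i e = 0" for i
    by (cases i) (simp_all add: e_def b phi_U rules to_poly)
  have "2 * \<phi> = \<phi>z * (2 * zz + qq^2 - 2 * uu^3) + 2 * b * uu + e"
    by (simp add: e_def)
  with g b e show ?thesis by blast
qed

end

section \<open>Smooth functions on jet space\<close>

lemma smooth_continuous: "smooth f \<Longrightarrow> continuous_on UNIV f"
  unfolding smooth_def Let_def by (metis foldr.simps(1) id_apply)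

lemma smooth_differentiable: "smooth f \<Longrightarrow> (\<lambda>s. f (J(c := s))) differentiable at (J c)"
  unfolding smooth_def Let_def by (metis foldr.simps(1) id_apply)

lemma smooth_partial:
  assumes "smooth f" shows "smooth (partial c f)"
  unfolding smooth_def
proof
  fix cs
  have "foldr partial cs (partial c f) = foldr partial (cs @ [c]) f" by simp
  then show "let g = foldr partial cs (partial c f) in
        continuous_on UNIV g \<and> (\<forall>c J. (\<lambda>s. g (J(c := s))) differentiable at (J c))"
    using assms unfolding smooth_def by presburger
qed

text \<open>
  Smoothness is the largest class of continuous, coordinatewise differentiable functions that is
  closed under partial derivatives; this is how it is established below.
\<close>

lemma smooth_coinduct:
  assumes "f \<in> S"
    and cont: "\<And>g. g \<in> S \<Longrightarrow> continuous_on UNIV g"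
    and diff: "\<And>g c J. g \<in> S \<Longrightarrow> (\<lambda>s. g (J(c := s))) differentiable at (J c)"
    and part: "\<And>g c. g \<in> S \<Longrightarrow> partial c g \<in> S"
  shows "smooth f"
proof -
  have "foldr partial cs f \<in> S" for cs
    by (induction cs) (use assms in auto)
  then show ?thesis
    unfolding smooth_def Let_def using cont diff by blast
qed

lemma smooth_has_partial:
  assumes "smooth f"
  shows "((\<lambda>s. f (J(c := s))) has_real_derivative partial c f (J(c := s))) (at s)"
proof -
  have "(\<lambda>s'. f (J(c := s'))) differentiable at s"
    using smooth_differentiable[OF assms, of "J(c := s)" c] by simp
  then show ?thesis
    by (simp add: partial_def DERIV_deriv_iff_real_differentiable)
qed

lemma smooth_has_partial':
  assumes "smooth f"
  shows "((\<lambda>s. f (J(c := s))) has_real_derivative partial c f J) (at (J c))"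
  using smooth_has_partial[OF assms, of J c "J c"] by simp

lemma partial_eqI:
  "((\<lambda>s. f (J(c := s))) has_real_derivative D) (at (J c)) \<Longrightarrow> partial c f J = D"
  by (simp add: partial_def DERIV_imp_deriv)

lemma partial_add:
  assumes "smooth f" "smooth g"
  shows "partial c (\<lambda>J. f J + g J) = (\<lambda>J. partial c f J + partial c g J)"
  by (rule ext, rule partial_eqI)
    (auto intro!: derivative_eq_intros smooth_has_partial' assms)

lemma partial_mult:
  assumes "smooth f" "smooth g"
  shows "partial c (\<lambda>J. f J * g J) = (\<lambda>J. partial c f J * g J + f J * partial c g J)"
  by (rule ext, rule partial_eqI)
    (auto intro!: derivative_eq_intros smooth_has_partial' assms)

text \<open>
  A partial derivative of a product is a sum of products, so the products of two smooth functions do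
  not form a class to which \<open>smooth_coinduct\<close> applies. The algebra generated by all smooth functions
  does, by the sum and product rules.
\<close>

inductive_set smooth_algebra :: "(jet \<Rightarrow> real) set" where
  base: "smooth f \<Longrightarrow> f \<in> smooth_algebra"
| add: "f \<in> smooth_algebra \<Longrightarrow> g \<in> smooth_algebra \<Longrightarrow> (\<lambda>J. f J + g J) \<in> smooth_algebra"
| mult: "f \<in> smooth_algebra \<Longrightarrow> g \<in> smooth_algebra \<Longrightarrow> (\<lambda>J. f J * g J) \<in> smooth_algebra"

lemma smooth_algebra_smooth:
  assumes "f \<in> smooth_algebra" shows "smooth f"
proof (rule smooth_coinduct[OF assms])
  have *: "continuous_on UNIV g \<and> (\<forall>c J. (\<lambda>s. g (J(c := s))) differentiable at (J c)) \<and>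
    (\<forall>c. partial c g \<in> smooth_algebra)" if "g \<in> smooth_algebra" for g
    using that
  proof induction
    case (base f)
    then show ?case
      using smooth_continuous smooth_differentiable smooth_partial smooth_algebra.base by blast
  next
    case (add f g)
    have D: "((\<lambda>s. h (J(c := s))) has_real_derivative partial c h J) (at (J c))"
      if "h \<in> {f, g}" for h c J
      using that add.IH unfolding partial_def DERIV_deriv_iff_real_differentiable by blast
    have "partial c (\<lambda>J. f J + g J) = (\<lambda>J. partial c f J + partial c g J)" for c
      by (rule ext, rule partial_eqI) (auto intro!: derivative_eq_intros D)
    then show ?case
      using add.hyps add.IH
      by (simp only: continuous_on_add differentiable_add smooth_algebra.intros simp_thms)
  next
    case (mult f g)
    have D: "((\<lambda>s. h (J(c := s))) has_real_derivative partial c h J) (at (J c))"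
      if "h \<in> {f, g}" for h c J
      using that mult.IH unfolding partial_def DERIV_deriv_iff_real_differentiable by blast
    have "partial c (\<lambda>J. f J * g J) = (\<lambda>J. partial c f J * g J + f J * partial c g J)" for c
      by (rule ext, rule partial_eqI) (auto intro!: derivative_eq_intros D)
    then show ?case
      using mult.hyps mult.IH
      by (simp only: continuous_on_mult differentiable_mult smooth_algebra.intros simp_thms)
  qed
  fix g c J
  assume "g \<in> smooth_algebra"
  then show "continuous_on UNIV g" "(\<lambda>s. g (J(c := s))) differentiable at (J c)"
    "partial c g \<in> smooth_algebra"
    using * by blast+
qed

lemma smooth_add: "smooth f \<Longrightarrow> smooth g \<Longrightarrow> smooth (\<lambda>J. f J + g J)"
  and smooth_mult: "smooth f \<Longrightarrow> smooth g \<Longrightarrow> smooth (\<lambda>J. f J * g J)"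
  by (rule smooth_algebra_smooth, blast intro: smooth_algebra.intros)+

lemma partial_const: "partial c (\<lambda>J. r) = (\<lambda>J. 0)"
  by (rule ext, rule partial_eqI) simp

lemma partial_coord: "partial c (\<lambda>J. J c') = (\<lambda>J. if c = c' then 1 else 0)"
  by (rule ext, rule partial_eqI) auto

lemma smooth_const: "smooth (\<lambda>J. r)"
  by (rule smooth_coinduct[where S = "range (\<lambda>r J. r)"]) (auto simp: partial_const)

lemma smooth_coord: "smooth (\<lambda>J. J c)"
proof (rule smooth_coinduct[where S = "insert (\<lambda>J. J c) (range (\<lambda>r J. r))"])
  fix g :: "jet \<Rightarrow> real" and c' J
  assume "g \<in> insert (\<lambda>J. J c) (range (\<lambda>r J. r))"
  then show "(\<lambda>s. g (J(c' := s))) differentiable at (J c')"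
    by (cases "c = c'") auto
qed (auto simp: partial_const partial_coord fun_upd_def intro!: continuous_on_product_coordinates)

text \<open>
  The second difference over a square is symmetric in the two variables, so it equals either mixed
  derivative at an intermediate point. Letting \<open>h\<close> tend to \<open>0\<close> yields Schwarz's theorem.
\<close>

lemma second_difference_mean_value:
  fixes F :: "real \<Rightarrow> real \<Rightarrow> real"
  assumes Fa: "\<And>x y. ((\<lambda>x. F x y) has_real_derivative Fa x y) (at x)"
    and Fab: "\<And>x y. ((\<lambda>y. Fa x y) has_real_derivative Fab x y) (at y)"
    and "0 < h"
  obtains x y where "a < x" "x < a + h" "b < y" "y < b + h"
    "F (a + h) (b + h) - F (a + h) b - F a (b + h) + F a b = h * h * Fab x y"
proof -
  have "((\<lambda>x. F x (b + h) - F x b) has_real_derivative Fa x (b + h) - Fa x b) (at x)" for x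
    by (intro derivative_intros Fa)
  from MVT2[of a "a + h", OF _ this] \<open>0 < h\<close> obtain x where x: "a < x" "x < a + h"
    "F (a + h) (b + h) - F (a + h) b - (F a (b + h) - F a b) = h * (Fa x (b + h) - Fa x b)"
    by auto
  from MVT2[of b "b + h" "Fa x", OF _ Fab] \<open>0 < h\<close> obtain y where y: "b < y" "y < b + h"
    "Fa x (b + h) - Fa x b = h * Fab x y"
    by auto
  from x y show thesis by (intro that[of x y]) (auto simp: algebra_simps)
qed

lemma mixed_derivatives_eq:
  fixes F :: "real \<Rightarrow> real \<Rightarrow> real"
  assumes Fa: "\<And>x y. ((\<lambda>x. F x y) has_real_derivative Fa x y) (at x)"
    and Fb: "\<And>x y. ((\<lambda>y. F x y) has_real_derivative Fb x y) (at y)"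
    and Fab: "\<And>x y. ((\<lambda>y. Fa x y) has_real_derivative Fab x y) (at y)"
    and Fba: "\<And>x y. ((\<lambda>x. Fb x y) has_real_derivative Fba x y) (at x)"
    and cont: "continuous_on UNIV (\<lambda>(x, y). Fab x y)" "continuous_on UNIV (\<lambda>(x, y). Fba x y)"
  shows "Fab a b = Fba a b"
proof -
  define h where "h n = inverse (real (Suc n))" for n
  have h0: "h \<longlonglongrightarrow> 0" unfolding h_def by (rule LIMSEQ_inverse_real_of_nat)
  have hpos: "h n > 0" for n by (simp add: h_def)
  define \<Delta> where "\<Delta> h = F (a + h) (b + h) - F (a + h) b - F a (b + h) + F a b" for h
  have "\<forall>n. \<exists>x y. a < x \<and> x < a + h n \<and> b < y \<and> y < b + h n \<and> \<Delta> (h n) = h n * h n * Fab x y"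
  proof
    fix n
    obtain x y where "a < x" "x < a + h n" "b < y" "y < b + h n" "\<Delta> (h n) = h n * h n * Fab x y"
      using second_difference_mean_value[OF Fa Fab hpos[of n], of a b] unfolding \<Delta>_def .
    then show "\<exists>x y. a < x \<and> x < a + h n \<and> b < y \<and> y < b + h n \<and> \<Delta> (h n) = h n * h n * Fab x y"
      by blast
  qed
  then obtain x y where xy: "\<forall>n. a < x n \<and> x n < a + h n \<and> b < y n \<and> y n < b + h n \<and>
      \<Delta> (h n) = h n * h n * Fab (x n) (y n)"
    unfolding choice_iff by blast
  have "\<forall>n. \<exists>x y. a < x \<and> x < a + h n \<and> b < y \<and> y < b + h n \<and> \<Delta> (h n) = h n * h n * Fba x y"
  proof
    fix n
    obtain y x where "b < y" "y < b + h n" "a < x" "x < a + h n"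
      "F (a + h n) (b + h n) - F a (b + h n) - F (a + h n) b + F a b = h n * h n * Fba x y"
      using second_difference_mean_value[of "\<lambda>y x. F x y" "\<lambda>y x. Fb x y" "\<lambda>y x. Fba x y",
          OF Fb Fba hpos[of n], of b a] .
    then show "\<exists>x y. a < x \<and> x < a + h n \<and> b < y \<and> y < b + h n \<and> \<Delta> (h n) = h n * h n * Fba x y"
      unfolding \<Delta>_def by (intro exI[of _ x] exI[of _ y]) simp
  qed
  then obtain x' y' where xy': "\<forall>n. a < x' n \<and> x' n < a + h n \<and> b < y' n \<and> y' n < b + h n \<and>
      \<Delta> (h n) = h n * h n * Fba (x' n) (y' n)"
    unfolding choice_iff by blast
  have eq: "Fab (x n) (y n) = Fba (x' n) (y' n)" for n
    using spec[OF xy, of n] spec[OF xy', of n] hpos[of n] by simp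
  have squeeze: "s \<longlonglongrightarrow> r" if "\<forall>n. r < s n \<and> s n < r + h n" for s and r :: real
  proof (rule tendsto_sandwich[of "\<lambda>_. r" s sequentially "\<lambda>n. r + h n"])
    show "(\<lambda>n. r + h n) \<longlonglongrightarrow> r" using tendsto_add[OF tendsto_const h0, of r] by simp
    show "\<forall>\<^sub>F n in sequentially. r \<le> s n" "\<forall>\<^sub>F n in sequentially. s n \<le> r + h n"
      using that by (auto intro!: always_eventually less_imp_le)
  qed simp
  have lim: "(\<lambda>n. G (s n) (s' n)) \<longlonglongrightarrow> G a b"
    if "continuous_on UNIV (\<lambda>(x, y). G x y)" "\<forall>n. a < s n \<and> s n < a + h n \<and> b < s' n \<and> s' n < b + h n"
    for G :: "real \<Rightarrow> real \<Rightarrow> real" and s s'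
  proof -
    have "(\<lambda>n. (s n, s' n)) \<longlonglongrightarrow> (a, b)"
      using that(2) by (intro tendsto_Pair squeeze) blast+
    from continuous_on_tendsto_compose[OF that(1) this] show ?thesis by simp
  qed
  have "(\<lambda>n. Fab (x n) (y n)) \<longlonglongrightarrow> Fab a b"
    by (rule lim[OF cont(1)]) (use xy in blast)
  moreover have "(\<lambda>n. Fba (x' n) (y' n)) \<longlonglongrightarrow> Fba a b"
    by (rule lim[OF cont(2)]) (use xy' in blast)
  ultimately show ?thesis by (simp add: eq LIMSEQ_unique)
qed

lemma partial_commute:
  assumes "smooth f"
  shows "partial c (partial c' f) = partial c' (partial c f)"
proof (cases "c = c'")
  case False
  show ?thesis
  proof
    fix J :: jet
    \<comment> \<open>the plane through \<open>J\<close> in which the two coordinates vary\<close>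
    define j where "j x y = J(c := x, c' := y)" for x y
    have j: "j x y = (J(c' := y))(c := x)" for x y
      using False by (auto simp: j_def)
    have cont_j: "continuous_on UNIV (\<lambda>(x, y). j x y)"
    proof (rule continuous_on_coordinatewise_then_product)
      show "continuous_on UNIV (\<lambda>p. (case p of (x, y) \<Rightarrow> j x y) i)" for i
        by (cases "i = c'"; cases "i = c")
          (simp_all add: j_def case_prod_beta continuous_on_fst continuous_on_snd)
    qed
    have Dc: "((\<lambda>x. g (j x y)) has_real_derivative partial c g (j x y)) (at x)" if "smooth g" for g x y
      unfolding j using smooth_has_partial[OF that] .
    have Dc': "((\<lambda>y. g (j x y)) has_real_derivative partial c' g (j x y)) (at y)" if "smooth g" for g x y
      unfolding j_def using smooth_has_partial[OF that] .
    have cont: "continuous_on UNIV (\<lambda>(x, y). g (j x y))" if "smooth g" for g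
      using continuous_on_compose2[OF smooth_continuous[OF that] cont_j]
      by (simp add: case_prod_beta)
    have "partial c' (partial c f) (j (J c) (J c')) = partial c (partial c' f) (j (J c) (J c'))"
      by (rule mixed_derivatives_eq[where F = "\<lambda>x y. f (j x y)"
          and Fa = "\<lambda>x y. partial c f (j x y)" and Fb = "\<lambda>x y. partial c' f (j x y)"
          and Fab = "\<lambda>x y. partial c' (partial c f) (j x y)"
          and Fba = "\<lambda>x y. partial c (partial c' f) (j x y)"])
        (rule Dc[OF assms] Dc'[OF assms] Dc'[OF smooth_partial[OF assms]]
          Dc[OF smooth_partial[OF assms]] cont[OF smooth_partial[OF smooth_partial[OF assms]]])+
    then show "partial c (partial c' f) J = partial c' (partial c f) J"
      by (simp add: j_def)
  qed
qed simp

lemma smooth_uminus: "smooth f \<Longrightarrow> smooth (\<lambda>J. - f J)"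
  using smooth_mult[OF smooth_const[of "-1"]] by simp

lemma smooth_diff: "smooth f \<Longrightarrow> smooth g \<Longrightarrow> smooth (\<lambda>J. f J - g J)"
  using smooth_add[OF _ smooth_uminus] by simp

lemma smooth_divide_const: "smooth f \<Longrightarrow> smooth (\<lambda>J. f J / r)"
  using smooth_mult[OF _ smooth_const[of "inverse r"]] by (simp add: divide_inverse)

lemma smooth_power: "smooth f \<Longrightarrow> smooth (\<lambda>J. f J ^ n)"
  by (induction n) (simp_all add: smooth_const smooth_mult)

lemmas smooth_intros = smooth_const smooth_coord smooth_add smooth_diff smooth_uminus smooth_mult
  smooth_divide_const smooth_power

lemma partial_uminus: "smooth f \<Longrightarrow> partial c (\<lambda>J. - f J) = (\<lambda>J. - partial c f J)"
  by (rule ext, rule partial_eqI) (auto intro!: derivative_eq_intros smooth_has_partial')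

lemma partial_diff:
  "smooth f \<Longrightarrow> smooth g \<Longrightarrow> partial c (\<lambda>J. f J - g J) = (\<lambda>J. partial c f J - partial c g J)"
  by (rule ext, rule partial_eqI) (auto intro!: derivative_eq_intros smooth_has_partial')

lemma partial_divide_const: "smooth f \<Longrightarrow> partial c (\<lambda>J. f J / r) = (\<lambda>J. partial c f J / r)"
  by (rule ext, rule partial_eqI)
    (auto simp: divide_inverse intro!: derivative_eq_intros smooth_has_partial')

lemma partial_power:
  assumes "smooth f"
  shows "partial c (\<lambda>J. f J ^ n) = (\<lambda>J. of_nat n * f J ^ (n - 1) * partial c f J)"
  by (rule ext, rule partial_eqI)
    (auto intro!: derivative_eq_intros smooth_has_partial'[OF assms])

lemmas partial_simps = partial_const partial_coord partial_add partial_diff partial_uminus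
  partial_mult partial_divide_const partial_power

section \<open>The ring of smooth functions\<close>

typedef smooth_fun = "{f. smooth f}" morphisms value_at Smooth
  using smooth_const by blast

setup_lifting type_definition_smooth_fun

instantiation smooth_fun :: comm_ring_1
begin

lift_definition zero_smooth_fun :: smooth_fun is "\<lambda>J. 0" by (rule smooth_const)
lift_definition one_smooth_fun :: smooth_fun is "\<lambda>J. 1" by (rule smooth_const)
lift_definition plus_smooth_fun :: "smooth_fun \<Rightarrow> smooth_fun \<Rightarrow> smooth_fun"
  is "\<lambda>f g J. f J + g J" by (rule smooth_add)
lift_definition minus_smooth_fun :: "smooth_fun \<Rightarrow> smooth_fun \<Rightarrow> smooth_fun"
  is "\<lambda>f g J. f J - g J" by (rule smooth_diff)
lift_definition uminus_smooth_fun :: "smooth_fun \<Rightarrow> smooth_fun"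
  is "\<lambda>f J. - f J" by (rule smooth_uminus)
lift_definition times_smooth_fun :: "smooth_fun \<Rightarrow> smooth_fun \<Rightarrow> smooth_fun"
  is "\<lambda>f g J. f J * g J" by (rule smooth_mult)

instance
  by standard (transfer, simp add: fun_eq_iff algebra_simps)+

end

lift_definition jet_var :: "jet_coord \<Rightarrow> smooth_fun" is "\<lambda>c J. J c" by (rule smooth_coord)
lift_definition pd :: "jet_coord \<Rightarrow> smooth_fun \<Rightarrow> smooth_fun" is partial by (rule smooth_partial)

lemma value_at_simps:
  "value_at 0 J = 0" "value_at 1 J = 1"
  "value_at (f + g) J = value_at f J + value_at g J"
  "value_at (f - g) J = value_at f J - value_at g J"
  "value_at (- f) J = - value_at f J"
  "value_at (f * g) J = value_at f J * value_at g J"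
  "value_at (jet_var c) J = J c"
  "value_at (pd c f) J = partial c (value_at f) J"
  by (transfer, simp)+

lemma value_at_numeral: "value_at (numeral n) J = numeral n"
  by (induction n) (simp_all only: numeral.simps value_at_simps)

lemma value_at_power: "value_at (f ^ n) J = value_at f J ^ n"
  by (induction n) (simp_all add: value_at_simps)

lemma smooth_fun_eqI: "(\<And>J. value_at f J = value_at g J) \<Longrightarrow> f = g"
  using value_at_inject by blast

lemma pd_simps:
  "pd c (f + g) = pd c f + pd c g"
  "pd c (f - g) = pd c f - pd c g"
  "pd c (f * g) = pd c f * g + f * pd c g"
  "pd c (jet_var c') = (if c = c' then 1 else 0)"
  by (transfer, simp add: partial_simps)+

lemma pd_commute: "pd c (pd c' f) = pd c' (pd c f)"
  by transfer (rule partial_commute)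

text \<open>
  Passing from \<open>u\<^sub>t\<^sub>x\<close> to \<open>z = u\<^sub>t\<^sub>x + u u\<^sub>x\<^sub>x\<close> changes the partial derivatives in \<open>u\<close> and \<open>u\<^sub>x\<^sub>x\<close>, as they are now
  taken at constant \<open>z\<close>.
\<close>

fun D :: "coord \<Rightarrow> smooth_fun \<Rightarrow> smooth_fun" where
  "D T f = pd TVar f"
| "D X f = pd XVar f"
| "D U f = pd (Deriv 0 0) f - jet_var (Deriv 0 2) * pd (Deriv 1 1) f"
| "D P f = pd (Deriv 1 0) f"
| "D Q f = pd (Deriv 0 1) f"
| "D R f = pd (Deriv 2 0) f"
| "D Z f = pd (Deriv 1 1) f"
| "D W f = pd (Deriv 0 2) f - jet_var (Deriv 0 0) * pd (Deriv 1 1) f"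

fun adapted_var :: "coord \<Rightarrow> smooth_fun" where
  "adapted_var T = jet_var TVar"
| "adapted_var X = jet_var XVar"
| "adapted_var U = jet_var (Deriv 0 0)"
| "adapted_var P = jet_var (Deriv 1 0)"
| "adapted_var Q = jet_var (Deriv 0 1)"
| "adapted_var R = jet_var (Deriv 2 0)"
| "adapted_var Z = jet_var (Deriv 1 1) + jet_var (Deriv 0 0) * jet_var (Deriv 0 2)"
| "adapted_var W = jet_var (Deriv 0 2)"

interpretation adapted: differential_ring D adapted_var
proof
  fix i j f g n
  show "D i (f + g) = D i f + D i g"
    by (cases i) (simp_all add: pd_simps algebra_simps)
  show "D i (f * g) = D i f * g + f * D i g"
    by (cases i) (simp_all add: pd_simps algebra_simps)
  show "D i (D j f) = D j (D i f)"
    by (cases i; cases j) (simp_all add: pd_simps pd_commute algebra_simps)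
  show "D i (adapted_var j) = (if i = j then 1 else 0)"
    by (cases i; cases j) (simp_all add: pd_simps)
  assume *: "numeral n * f = 0"
  show "f = 0"
  proof (rule smooth_fun_eqI)
    fix J
    have "value_at (numeral n * f) J = 0" using * by (simp add: value_at_simps)
    then show "value_at f J = value_at 0 J" by (simp add: value_at_simps value_at_numeral)
  qed
qed

section \<open>Functions of finite order\<close>

lemma depends_upto_mono: "depends_upto m f \<Longrightarrow> m \<le> n \<Longrightarrow> depends_upto n f"
  unfolding depends_upto_def jet_eq_upto_def by (meson le_trans)

lemma depends_upto_diff_order: "depends_upto n f \<Longrightarrow> depends_upto (diff_order f) f"
  unfolding diff_order_def by (rule LeastI)

lemma diff_order_le: "depends_upto n f \<Longrightarrow> diff_order f \<le> n"
  unfolding diff_order_def by (rule Least_le)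

lemma differential_function_iff:
  "differential_function f \<and> diff_order f \<le> n \<longleftrightarrow> smooth f \<and> depends_upto n f"
  unfolding differential_function_def
  using depends_upto_mono depends_upto_diff_order diff_order_le by blast

lemma depends_upto_const: "depends_upto n (\<lambda>J. r)"
  by (simp add: depends_upto_def)

lemma depends_upto_coord: "a + b \<le> n \<Longrightarrow> depends_upto n (\<lambda>J. J (Deriv a b))"
  by (simp add: depends_upto_def jet_eq_upto_def)

lemma depends_upto_comp2:
  "depends_upto n f \<Longrightarrow> depends_upto n g \<Longrightarrow> depends_upto n (\<lambda>J. F (f J) (g J))"
  unfolding depends_upto_def by metis

lemmas depends_upto_intros = depends_upto_const depends_upto_coord
  depends_upto_comp2[where F = "(+)"] depends_upto_comp2[where F = "(-)"]
  depends_upto_comp2[where F = "(*)"] depends_upto_comp2[where F = "\<lambda>x y. x / y", OF _ depends_upto_const]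
  depends_upto_comp2[where F = "\<lambda>x y. x ^ m" for m, OF _ depends_upto_const]

lemma jet_eq_upto_upd_high: "a + b > n \<Longrightarrow> jet_eq_upto n (J(Deriv a b := s)) J"
  by (auto simp: jet_eq_upto_def)

lemma jet_eq_upto_upd: "jet_eq_upto n J J' \<Longrightarrow> jet_eq_upto n (J(c := s)) (J'(c := s))"
  by (auto simp: jet_eq_upto_def)

lemma partial_high_order:
  assumes "depends_upto n f" "a + b > n"
  shows "partial (Deriv a b) f = (\<lambda>J. 0)"
proof (rule ext, rule partial_eqI)
  fix J
  have "(\<lambda>s. f (J(Deriv a b := s))) = (\<lambda>s. f J)"
    using assms jet_eq_upto_upd_high unfolding depends_upto_def by blast
  then show "((\<lambda>s. f (J(Deriv a b := s))) has_real_derivative 0) (at (J (Deriv a b)))"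
    by simp
qed

lemma depends_upto_partial:
  assumes "depends_upto n f"
  shows "depends_upto n (partial c f)"
proof (cases "\<exists>a b. c = Deriv a b \<and> a + b > n")
  case True
  then show ?thesis using partial_high_order[OF assms] by (auto simp: depends_upto_const)
next
  case False
  show ?thesis
    unfolding depends_upto_def
  proof (intro allI impI)
    fix J J' assume eq: "jet_eq_upto n J J'"
    have "J c = J' c"
      using eq False by (cases c) (auto simp: jet_eq_upto_def not_less)
    moreover have "f (J(c := s)) = f (J'(c := s))" for s
      using assms jet_eq_upto_upd[OF eq] unfolding depends_upto_def by blast
    ultimately show "partial c f J = partial c f J'"
      by (simp add: partial_def)
  qed
qed

lemma finite_multi_indices: "finite {(a, b). a + b \<le> (n::nat)}"
  by (rule finite_subset[of _ "{..n} \<times> {..n}"]) auto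

text \<open>
  The total derivatives sum up to the exact order of the function. Any upper bound \<open>n\<close> of the order
  gives the same value, so functions of different orders can be treated together.
\<close>

lemma
  assumes "depends_upto n f"
  shows total_t_eq: "total_t f J = partial TVar f J +
     (\<Sum>(a, b)\<in>{(a, b). a + b \<le> n}. J (Deriv (Suc a) b) * partial (Deriv a b) f J)"
    and total_x_eq: "total_x f J = partial XVar f J +
     (\<Sum>(a, b)\<in>{(a, b). a + b \<le> n}. J (Deriv a (Suc b)) * partial (Deriv a b) f J)"
proof -
  have sub: "{(a, b). a + b \<le> diff_order f} \<subseteq> {(a, b). a + b \<le> n}"
    using diff_order_le[OF assms] by auto
  have within: "a + b \<le> diff_order f" if "partial (Deriv a b) f J \<noteq> 0" for a b
    using partial_high_order[OF depends_upto_diff_order[OF assms], of a b] that by force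
  show "total_t f J = partial TVar f J +
     (\<Sum>(a, b)\<in>{(a, b). a + b \<le> n}. J (Deriv (Suc a) b) * partial (Deriv a b) f J)"
    unfolding total_t_def add_left_cancel
    by (rule sum.mono_neutral_left[OF finite_multi_indices sub]) (auto intro: within)
  show "total_x f J = partial XVar f J +
     (\<Sum>(a, b)\<in>{(a, b). a + b \<le> n}. J (Deriv a (Suc b)) * partial (Deriv a b) f J)"
    unfolding total_x_def add_left_cancel
    by (rule sum.mono_neutral_left[OF finite_multi_indices sub]) (auto intro: within)
qed

lemma multi_indices_2: "{(a, b). a + b \<le> (2::nat)} = {(0,0), (0,1), (0,2), (1,0), (1,1), (2,0)}"
  by auto

lemma total_t_2:
  assumes "depends_upto 2 f"
  shows "total_t f J = partial TVar f J + J (Deriv 1 0) * partial (Deriv 0 0) f J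
    + J (Deriv 1 1) * partial (Deriv 0 1) f J + J (Deriv 1 2) * partial (Deriv 0 2) f J
    + J (Deriv 2 0) * partial (Deriv 1 0) f J + J (Deriv 2 1) * partial (Deriv 1 1) f J
    + J (Deriv 3 0) * partial (Deriv 2 0) f J"
  unfolding total_t_eq[OF assms] multi_indices_2 by (simp add: numeral_2_eq_2 numeral_3_eq_3)

lemma total_x_2:
  assumes "depends_upto 2 f"
  shows "total_x f J = partial XVar f J + J (Deriv 0 1) * partial (Deriv 0 0) f J
    + J (Deriv 0 2) * partial (Deriv 0 1) f J + J (Deriv 0 3) * partial (Deriv 0 2) f J
    + J (Deriv 1 1) * partial (Deriv 1 0) f J + J (Deriv 1 2) * partial (Deriv 1 1) f J
    + J (Deriv 2 1) * partial (Deriv 2 0) f J"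
  unfolding total_x_eq[OF assms] multi_indices_2 by (simp add: numeral_2_eq_2 numeral_3_eq_3)

lemma
  assumes "smooth f" "smooth g" "depends_upto n f" "depends_upto n g"
  shows total_t_lincomb: "total_t (\<lambda>J. r * f J + s * g J) J = r * total_t f J + s * total_t g J"
    and total_x_lincomb: "total_x (\<lambda>J. r * f J + s * g J) J = r * total_x f J + s * total_x g J"
proof -
  have dep: "depends_upto n (\<lambda>J. r * f J + s * g J)"
    using assms(3,4) by (rule depends_upto_comp2)
  have "partial c (\<lambda>J. r * f J + s * g J) = (\<lambda>J. r * partial c f J + s * partial c g J)" for c
    by (simp add: partial_simps smooth_intros assms)
  then show "total_t (\<lambda>J. r * f J + s * g J) J = r * total_t f J + s * total_t g J"
    and "total_x (\<lambda>J. r * f J + s * g J) J = r * total_x f J + s * total_x g J"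
    by (simp_all add: total_t_eq[OF dep] total_t_eq[OF assms(3)] total_t_eq[OF assms(4)]
        total_x_eq[OF dep] total_x_eq[OF assms(3)] total_x_eq[OF assms(4)]
        algebra_simps sum_distrib_left sum.distrib case_prod_beta)
qed

section \<open>From a conserved current to its characteristic\<close>

text \<open>
  On jets that differ only in third-order coordinates, all functions of order two and their
  partial derivatives take the same values. The divergence identity on such jets is thus an
  identity between affine functions of the third-order coordinates.
\<close>

lemma balance_split:
  assumes A: "smooth A" "depends_upto 2 A" and B: "smooth B" "depends_upto 2 B"
    and \<phi>: "depends_upto 2 \<phi>" and div: "\<And>J. total_div (A, B) J = \<phi> J * eqn J"
  shows "partial (Deriv 2 0) A J = 0"
    and "partial (Deriv 1 1) A J + partial (Deriv 2 0) B J = 0"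
    and "partial (Deriv 0 2) A J + partial (Deriv 1 1) B J = - \<phi> J"
    and "partial (Deriv 0 2) B J = - (u J * \<phi> J)"
    and "partial TVar A J + u_t J * partial (Deriv 0 0) A J + u_tx J * partial (Deriv 0 1) A J
      + J (Deriv 2 0) * partial (Deriv 1 0) A J
      + (partial XVar B J + u_x J * partial (Deriv 0 0) B J + u_xx J * partial (Deriv 0 1) B J
      + u_tx J * partial (Deriv 1 0) B J)
      = \<phi> J * (u_t J + 3 * (u J)^2 * u_x J - 2 * u_x J * u_xx J)"
proof -
  define K where "K \<alpha> \<beta> \<gamma> \<delta> = J(Deriv 3 0 := \<alpha>, Deriv 2 1 := \<beta>, Deriv 1 2 := \<gamma>, Deriv 0 3 := \<delta>)"
    for \<alpha> \<beta> \<gamma> \<delta>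
  have eq: "jet_eq_upto 2 (K \<alpha> \<beta> \<gamma> \<delta>) J" for \<alpha> \<beta> \<gamma> \<delta>
    by (auto simp: jet_eq_upto_def K_def)
  have inv: "f (K \<alpha> \<beta> \<gamma> \<delta>) = f J" if "depends_upto 2 f" for f \<alpha> \<beta> \<gamma> \<delta>
    using that eq unfolding depends_upto_def by blast
  note invs = inv[OF depends_upto_partial[OF A(2)]] inv[OF depends_upto_partial[OF B(2)]] inv[OF \<phi>]
  define S where "S = partial TVar A J + u_t J * partial (Deriv 0 0) A J + u_tx J * partial (Deriv 0 1) A J
      + J (Deriv 2 0) * partial (Deriv 1 0) A J
      + (partial XVar B J + u_x J * partial (Deriv 0 0) B J + u_xx J * partial (Deriv 0 1) B J
      + u_tx J * partial (Deriv 1 0) B J)"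
  have main: "S + \<alpha> * partial (Deriv 2 0) A J
     + \<beta> * (partial (Deriv 1 1) A J + partial (Deriv 2 0) B J)
     + \<gamma> * (partial (Deriv 0 2) A J + partial (Deriv 1 1) B J)
     + \<delta> * partial (Deriv 0 2) B J
     = \<phi> J * (u_t J - \<gamma> + 3 * (u J)^2 * u_x J - (u J * \<delta> + 2 * u_x J * u_xx J))"
    for \<alpha> \<beta> \<gamma> \<delta>
    using div[of "K \<alpha> \<beta> \<gamma> \<delta>"]
    by (simp add: total_div_def total_t_2[OF A(2)] total_x_2[OF B(2)] eqn_def invs S_def)
      (simp add: K_def algebra_simps)
  note at0 = main[of 0 0 0 0]
  show "partial (Deriv 2 0) A J = 0"
    using main[of 1 0 0 0] at0 by simp
  show "partial (Deriv 1 1) A J + partial (Deriv 2 0) B J = 0"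
    using main[of 0 1 0 0] at0 by simp
  show "partial (Deriv 0 2) A J + partial (Deriv 1 1) B J = - \<phi> J"
    using main[of 0 0 1 0] at0 by (simp add: algebra_simps)
  show "partial (Deriv 0 2) B J = - (u J * \<phi> J)"
    using main[of 0 0 0 1] at0 by (simp add: algebra_simps)
  show "partial TVar A J + u_t J * partial (Deriv 0 0) A J + u_tx J * partial (Deriv 0 1) A J
      + J (Deriv 2 0) * partial (Deriv 1 0) A J
      + (partial XVar B J + u_x J * partial (Deriv 0 0) B J + u_xx J * partial (Deriv 0 1) B J
      + u_tx J * partial (Deriv 1 0) B J)
      = \<phi> J * (u_t J + 3 * (u J)^2 * u_x J - 2 * u_x J * u_xx J)"
    using at0 by (simp add: S_def)
qed

definition "coords2 = {TVar, XVar} \<union> (\<lambda>(a, b). Deriv a b) ` {(a, b). a + b \<le> 2}"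

lemma coords2_eq:
  "coords2 = {TVar, XVar, Deriv 0 0, Deriv 0 1, Deriv 0 2, Deriv 1 0, Deriv 1 1, Deriv 2 0}"
  unfolding coords2_def multi_indices_2 by auto

definition restrict2 :: "jet \<Rightarrow> jet" where
  "restrict2 J = (\<lambda>c. if c \<in> coords2 then J c else 0)"

lemma restrict2: "jet_eq_upto 2 (restrict2 J) J"
  by (auto simp: restrict2_def coords2_def jet_eq_upto_def)

text \<open>
  A ring element killed by all eight derivations may still depend on coordinates of higher order.
  It is constant on the jets \<open>restrict2 J\<close>, and these suffice to know a function of order two.
\<close>

lemma constant_on_restricted_jets:
  assumes f: "smooth f" and 0: "\<And>c. c \<in> coords2 \<Longrightarrow> partial c f = (\<lambda>J. 0)"
  shows "f (restrict2 J) = f (\<lambda>c. 0)"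
proof -
  have "f (\<lambda>c. if c \<in> S then J c else 0) = f (\<lambda>c. 0)" if "finite S" "S \<subseteq> coords2" for S
    using that
  proof induction
    case (insert c S)
    define K where "K = (\<lambda>c. if c \<in> S then J c else 0)"
    have "((\<lambda>s. f (K(c := s))) has_real_derivative 0) (at s)" for s
      using smooth_has_partial[OF f, of K c s] 0[of c] insert.prems by simp
    then have "f (K(c := J c)) = f (K(c := 0))"
      by (rule DERIV_isconst_all[rule_format])
    moreover have "K(c := J c) = (\<lambda>c'. if c' \<in> insert c S then J c' else 0)" "K(c := 0) = K"
      using insert.hyps by (auto simp: K_def)
    ultimately show ?case
      using insert by (simp add: K_def)
  qed simp
  from this[of coords2] show ?thesis
    by (simp add: restrict2_def coords2_eq)
qed

text \<open>The characteristic of the third current.\<close>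

definition characteristic3 :: "jet \<Rightarrow> real" where
  "characteristic3 J = (u J)^3 - u J * u_xx J - (u_x J)^2 / 2 - u_tx J"

text \<open>
  The constants come from the values at the zero jet of the ring elements that \<open>characteristic\<close>
  provides; \<open>c\<close> has the opposite sign because \<open>2 z + q\<^sup>2 - 2 u\<^sup>3\<close> is \<open>- 2 characteristic3\<close>.
\<close>

theorem characteristic_form:
  assumes A: "smooth A" "depends_upto 2 A" and B: "smooth B" "depends_upto 2 B"
    and \<phi>: "smooth \<phi>" "depends_upto 2 \<phi>" and div: "\<And>J. total_div (A, B) J = \<phi> J * eqn J"
  shows "\<exists>a b c. \<forall>J. \<phi> J = a + b * u J + c * characteristic3 J"
proof -
  note split = balance_split[OF A B \<phi>(2) div]
  define A' B' \<phi>' where "A' = Smooth A" and "B' = Smooth B" and "\<phi>' = Smooth \<phi>"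
  have [simp]: "value_at A' = A" "value_at B' = B" "value_at \<phi>' = \<phi>"
    using A(1) B(1) \<phi>(1) by (simp_all add: A'_def B'_def \<phi>'_def Smooth_inverse)
  interpret conservation_law D adapted_var A' B' \<phi>'
  proof
    show "D R A' = 0"
      by (rule smooth_fun_eqI, use split(1) in \<open>simp add: value_at_simps\<close>)
    show "D Z A' + D R B' = 0"
      by (rule smooth_fun_eqI, use split(2) in \<open>simp add: value_at_simps\<close>)
    show "D W A' + adapted_var U * D Z A' + D Z B' = - \<phi>'"
      by (rule smooth_fun_eqI, use split(3) in \<open>simp add: value_at_simps\<close>)
    show "D W B' + adapted_var U * D Z B' = - (adapted_var U * \<phi>')"
      by (rule smooth_fun_eqI, use split(4) in \<open>simp add: value_at_simps\<close>)
    show "D T A' + adapted_var P * (D U A' + adapted_var W * D Z A') + adapted_var R * D P A'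
      + (adapted_var Z - adapted_var U * adapted_var W) * D Q A'
      + (D X B' + adapted_var Q * (D U B' + adapted_var W * D Z B')
        + (adapted_var Z - adapted_var U * adapted_var W) * D P B' + adapted_var W * D Q B')
      = \<phi>' * (adapted_var P + 3 * (adapted_var U)^2 * adapted_var Q - 2 * adapted_var Q * adapted_var W)"
    proof (rule smooth_fun_eqI, goal_cases)
      case (1 J)
      show ?case using split(5)[of J]
        by (simp add: value_at_simps value_at_numeral value_at_power algebra_simps)
    qed
  qed
  obtain g b e where const: "\<forall>i. D i g = 0 \<and> D i b = 0 \<and> D i e = 0"
    and eq: "2 * \<phi>' = g * (2 * adapted_var Z + (adapted_var Q)^2 - 2 * (adapted_var U)^3)
      + 2 * b * adapted_var U + e"
    using characteristic by blast
  have const': "value_at f (restrict2 J) = value_at f (\<lambda>c. 0)" if "\<forall>i. D i f = 0" for f J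
  proof (rule constant_on_restricted_jets)
    show "smooth (value_at f)" using value_at by auto
    have Z: "pd (Deriv 1 1) f = 0" using that[rule_format, of Z] by simp
    have "pd c f = 0" if "c \<in> coords2" for c
      using that \<open>\<forall>i. D i f = 0\<close>[rule_format, of T] \<open>\<forall>i. D i f = 0\<close>[rule_format, of X]
        \<open>\<forall>i. D i f = 0\<close>[rule_format, of U] \<open>\<forall>i. D i f = 0\<close>[rule_format, of P]
        \<open>\<forall>i. D i f = 0\<close>[rule_format, of Q] \<open>\<forall>i. D i f = 0\<close>[rule_format, of R]
        \<open>\<forall>i. D i f = 0\<close>[rule_format, of W] Z
      by (auto simp: coords2_eq)
    then show "partial c (value_at f) = (\<lambda>J. 0)" if "c \<in> coords2" for c
      using that value_at_simps(8)[of c f] value_at_simps(1) by (auto simp: fun_eq_iff)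
  qed
  have "\<phi> J = value_at e (\<lambda>c. 0) / 2 + value_at b (\<lambda>c. 0) * u J + (- value_at g (\<lambda>c. 0)) * characteristic3 J" for J
  proof -
    have "\<phi> J = \<phi> (restrict2 J)"
      using \<phi>(2) restrict2 unfolding depends_upto_def by metis
    moreover have "2 * \<phi> (restrict2 J) = value_at (2 * \<phi>') (restrict2 J)"
      by (simp add: value_at_simps value_at_numeral)
    moreover have "\<dots> = value_at g (\<lambda>c. 0) * (2 * (u_tx J + u J * u_xx J) + (u_x J)^2 - 2 * (u J)^3)
       + 2 * value_at b (\<lambda>c. 0) * u J + value_at e (\<lambda>c. 0)"
      unfolding eq
      by (simp add: value_at_simps value_at_numeral value_at_power const' const)
        (simp add: restrict2_def coords2_eq)
    ultimately show ?thesis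
      by (simp add: characteristic3_def field_simps)
  qed
  then show ?thesis by blast
qed

section \<open>The three currents and the classification\<close>

lemma total_div_current_diff:
  assumes "smooth (fst C)" "smooth (snd C)" "smooth (fst C')" "smooth (snd C')"
    and "depends_upto n (fst C)" "depends_upto n (snd C)" "depends_upto n (fst C')" "depends_upto n (snd C')"
  shows "total_div (current_diff C C') J = total_div C J - total_div C' J"
  using total_t_lincomb[of "fst C" "fst C'" n 1 "-1" J] total_x_lincomb[of "snd C" "snd C'" n 1 "-1" J] assms
  by (simp add: total_div_def current_diff_def)

lemma current1_props:
  "smooth (fst current1)" "smooth (snd current1)" "depends_upto 2 (fst current1)" "depends_upto 2 (snd current1)"
  unfolding current1_def fst_conv snd_conv
  by (intro smooth_intros depends_upto_intros; simp)+

lemma current2_props: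
  "smooth (fst current2)" "smooth (snd current2)" "depends_upto 2 (fst current2)" "depends_upto 2 (snd current2)"
  unfolding current2_def fst_conv snd_conv
  by (intro smooth_intros depends_upto_intros; simp)+

lemma current3_props:
  "smooth (fst current3)" "smooth (snd current3)" "depends_upto 2 (fst current3)" "depends_upto 2 (snd current3)"
  unfolding current3_def fst_conv snd_conv
  by (intro smooth_intros depends_upto_intros; simp)+

lemma characteristic3_props: "smooth characteristic3" "depends_upto 2 characteristic3"
  unfolding characteristic3_def[abs_def]
  by (intro smooth_intros depends_upto_intros; simp)+

lemma total_div_current1: "total_div current1 J = eqn J"
  unfolding total_div_def total_t_2[OF current1_props(3)] total_x_2[OF current1_props(4)]
  by (simp add: current1_def partial_simps smooth_intros eqn_def power2_eq_square power3_eq_cube algebra_simps)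

lemma total_div_current2: "total_div current2 J = u J * eqn J"
  unfolding total_div_def total_t_2[OF current2_props(3)] total_x_2[OF current2_props(4)]
  by (simp add: current2_def partial_simps smooth_intros eqn_def field_simps eval_nat_numeral)

lemma total_div_current3: "total_div current3 J = characteristic3 J * eqn J"
  unfolding total_div_def total_t_2[OF current3_props(3)] total_x_2[OF current3_props(4)]
  by (simp add: current3_def partial_simps smooth_intros eqn_def characteristic3_def field_simps eval_nat_numeral)

lemma lin_comb3_closed:
  assumes "smooth (fst A)" "smooth (snd A)" "depends_upto n (fst A)" "depends_upto n (snd A)"
    and "smooth (fst B)" "smooth (snd B)" "depends_upto n (fst B)" "depends_upto n (snd B)"
    and "smooth (fst C)" "smooth (snd C)" "depends_upto n (fst C)" "depends_upto n (snd C)"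
  shows "smooth (fst (lin_comb3 a A b B c C))" "smooth (snd (lin_comb3 a A b B c C))"
    "depends_upto n (fst (lin_comb3 a A b B c C))" "depends_upto n (snd (lin_comb3 a A b B c C))"
    "total_div (lin_comb3 a A b B c C) J = a * total_div A J + b * total_div B J + c * total_div C J"
proof -
  have AB: "smooth (\<lambda>J. a * fst A J + b * fst B J)" "smooth (\<lambda>J. a * snd A J + b * snd B J)"
    "depends_upto n (\<lambda>J. a * fst A J + b * fst B J)" "depends_upto n (\<lambda>J. a * snd A J + b * snd B J)"
    by (intro smooth_intros depends_upto_intros assms)+
  show "smooth (fst (lin_comb3 a A b B c C))" "smooth (snd (lin_comb3 a A b B c C))"
    "depends_upto n (fst (lin_comb3 a A b B c C))" "depends_upto n (snd (lin_comb3 a A b B c C))"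
    unfolding lin_comb3_def fst_conv snd_conv
    by (intro smooth_intros depends_upto_intros assms)+
  show "total_div (lin_comb3 a A b B c C) J = a * total_div A J + b * total_div B J + c * total_div C J"
    using total_t_lincomb[OF AB(1) assms(9) AB(3) assms(11), of 1 c J]
      total_x_lincomb[OF AB(2) assms(10) AB(4) assms(12), of 1 c J]
      total_t_lincomb[OF assms(1,5,3,7), of a b J] total_x_lincomb[OF assms(2,6,4,8), of a b J]
    by (simp add: total_div_def lin_comb3_def algebra_simps)
qed

lemma second_order_conserved_current_iff:
  assumes "smooth (fst C)" "smooth (snd C)" "depends_upto 2 (fst C)" "depends_upto 2 (snd C)"
  shows "second_order_conserved_current C \<longleftrightarrow>
    (\<exists>\<phi>. smooth \<phi> \<and> depends_upto 2 \<phi> \<and> (\<forall>J. total_div C J = \<phi> J * eqn J))"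
proof -
  have "differential_pair C" "current_order C \<le> 2"
    using assms differential_function_iff
    unfolding differential_pair_def current_order_def by auto
  moreover have "(\<exists>\<phi>. has_characteristic eqn C \<phi> \<and> diff_order \<phi> \<le> 2) \<longleftrightarrow>
      (\<exists>\<phi>. smooth \<phi> \<and> depends_upto 2 \<phi> \<and> (\<forall>J. total_div C J = \<phi> J * eqn J))"
    unfolding has_characteristic_def using differential_function_iff[of _ 2] by blast
  ultimately show ?thesis
    unfolding second_order_conserved_current_def conserved_current_def by blast
qed

theorem theorem3p2:
  shows "(\<forall>C \<in> {current1, current2, current3}. second_order_conserved_current C) \<and>
    (\<forall>C. differential_pair C \<and> current_order C \<le> 2 \<longrightarrow>
       (second_order_conserved_current C \<longleftrightarrow>
        (\<exists>a b c. trivial_current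
           (current_diff C (lin_comb3 a current1 b current2 c current3)))))"
proof (intro conjI allI impI)
  have "second_order_conserved_current current1"
    unfolding second_order_conserved_current_iff[OF current1_props]
    by (rule exI[of _ "\<lambda>J. 1"]) (simp add: smooth_const depends_upto_const total_div_current1)
  moreover have "second_order_conserved_current current2"
    unfolding second_order_conserved_current_iff[OF current2_props]
    by (rule exI[of _ "\<lambda>J. u J"]) (simp add: smooth_coord depends_upto_coord total_div_current2)
  moreover have "second_order_conserved_current current3"
    unfolding second_order_conserved_current_iff[OF current3_props]
    by (rule exI[of _ characteristic3]) (simp add: characteristic3_props total_div_current3)
  ultimately show "\<forall>C \<in> {current1, current2, current3}. second_order_conserved_current C"
    by blast
next
  fix C
  assume "differential_pair C \<and> current_order C \<le> 2"
  then have C: "smooth (fst C)" "smooth (snd C)" "depends_upto 2 (fst C)" "depends_upto 2 (snd C)"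
    using differential_function_iff unfolding differential_pair_def current_order_def by auto
  let ?L = "\<lambda>a b c. lin_comb3 a current1 b current2 c current3"
  note L = lin_comb3_closed[OF current1_props current2_props current3_props]
  have div_L: "total_div (?L a b c) J = (a + b * u J + c * characteristic3 J) * eqn J" for a b c J
    by (simp add: L(5) total_div_current1 total_div_current2 total_div_current3 algebra_simps)
  have "trivial_current (current_diff C (?L a b c)) \<longleftrightarrow>
      (\<forall>J. total_div C J = (a + b * u J + c * characteristic3 J) * eqn J)" for a b c
  proof -
    have "differential_pair (current_diff C (?L a b c))"
      unfolding differential_pair_def differential_function_def current_diff_def fst_conv snd_conv
      using smooth_intros(4)[OF C(1) L(1)] smooth_intros(4)[OF C(2) L(2)]
        depends_upto_comp2[where F = "(-)", OF C(3) L(3)] depends_upto_comp2[where F = "(-)", OF C(4) L(4)]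
      by blast
    then show ?thesis
      unfolding trivial_current_def
      by (simp add: total_div_current_diff[OF C(1,2) L(1,2) C(3,4) L(3,4)] div_L)
  qed
  moreover have "second_order_conserved_current C \<longleftrightarrow>
      (\<exists>a b c. \<forall>J. total_div C J = (a + b * u J + c * characteristic3 J) * eqn J)" (is "?cons \<longleftrightarrow> ?form")
  proof
    assume ?cons
    then obtain \<phi> where \<phi>: "smooth \<phi>" "depends_upto 2 \<phi>" "\<And>J. total_div C J = \<phi> J * eqn J"
      using second_order_conserved_current_iff[OF C] by blast
    then obtain a b c where "\<forall>J. \<phi> J = a + b * u J + c * characteristic3 J"
      using characteristic_form[OF C(1,3) C(2,4) \<phi>(1,2)] by auto
    with \<phi>(3) show ?form by auto
  next
    assume ?form
    then obtain a b c where *: "\<forall>J. total_div C J = (a + b * u J + c * characteristic3 J) * eqn J"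
      by blast
    have "smooth (\<lambda>J. a + b * u J + c * characteristic3 J)" "depends_upto 2 (\<lambda>J. a + b * u J + c * characteristic3 J)"
      by (intro smooth_intros depends_upto_intros characteristic3_props; simp)+
    with * show ?cons
      unfolding second_order_conserved_current_iff[OF C] by blast
  qed
  ultimately show "second_order_conserved_current C \<longleftrightarrow>
        (\<exists>a b c. trivial_current (current_diff C (?L a b c)))"
    by simp
qed

end
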